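(* Let $\mathbb{G}$ be an infinite, connected, locally finite graph with basepoint $o\in V(\mathbb{G})$ such that $\imath_E^*(\mathbb{G})>0$. Then there exists $p_0<1$ such that for every $p\in(p_0,1)$ the following holds. Consider $p$-Bernoulli bond percolation on $\mathbb{G}$ and let $\mathbb{H}$ be the open cluster containing $o$. Then almost surely on the event that $\mathbb{H}$ is infinite, $\imath_E^*(\mathbb{H})>0$.
   Context: For a graph $G$ and $S\subset V(G)$, $|S|$ is the cardinality of $S$, and $\partial_G S$ (also written $\partial S$) is the set of edges of $G$ with one end in $S$ and the other in $S^c$. $S$ is called connected if the subgraph of $G$ induced on $S$ is connected. For an infinite connected graph $G$ with basepoint $o$, the anchored expansion constant is $$\imath_E^*(G):=\lim_{n\to\infty}\inf\left\{\frac{|\partial S|}{|S|}: o\in S\subset V(G),\ S\text{ is connected},\ n\le |S|<\infty\right\};$$ it does not depend on the choice of $o$. In $p$-Bernoulli bond percolation on $\mathbb{G}$, each edge of $\mathbb{G}$ is independently declared open with probability $p$ and closed with probability $1-p$; an open cluster is a connected component of the subgraph formed by the open edges, regarded as a graph whose edges are its open edges. The constant $\imath_E^*(\mathbb{H})$ is computed in the random graph $\mathbb{H}$. *)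

theory Defs
  imports "HOL-Probability.Probability"
begin

text \<open>An undirected simple graph is given by a vertex set and a set of two-element subsets of it.\<close>

definition simple_graph :: "'v set \<Rightarrow> 'v set set \<Rightarrow> bool" where
  "simple_graph V E \<longleftrightarrow> (\<forall>e\<in>E. e \<subseteq> V \<and> card e = 2)"

definition locally_finite_graph :: "'v set \<Rightarrow> 'v set set \<Rightarrow> bool" where
  "locally_finite_graph V E \<longleftrightarrow> (\<forall>v\<in>V. finite {e \<in> E. v \<in> e})"

definition reachable :: "'v set set \<Rightarrow> 'v \<Rightarrow> 'v \<Rightarrow> bool" where
  "reachable E = (\<lambda>u v. {u, v} \<in> E)\<^sup>*\<^sup>*"

definition connected_graph :: "'v set \<Rightarrow> 'v set set \<Rightarrow> bool" where
  "connected_graph V E \<longleftrightarrow> V \<noteq> {} \<and> (\<forall>u\<in>V. \<forall>v\<in>V. reachable E u v)"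

definition induced_edges :: "'v set set \<Rightarrow> 'v set \<Rightarrow> 'v set set" where
  "induced_edges E S = {e \<in> E. e \<subseteq> S}"

definition edge_boundary :: "'v set \<Rightarrow> 'v set set \<Rightarrow> 'v set \<Rightarrow> 'v set set" where
  "edge_boundary V E S = {e \<in> E. \<exists>u\<in>S. \<exists>v\<in>V - S. e = {u, v}}"

definition anchored_sets :: "'v set \<Rightarrow> 'v set set \<Rightarrow> 'v \<Rightarrow> nat \<Rightarrow> 'v set set" where
  "anchored_sets V E r n =
     {S. r \<in> S \<and> S \<subseteq> V \<and> connected_graph S (induced_edges E S) \<and> finite S \<and> n \<le> card S}"

text \<open>The limit may be infinite when the degrees are unbounded, hence the type \<^typ>\<open>ereal\<close>.
  In a locally finite graph the boundary of a finite set is finite, so \<^const>\<open>card\<close> counts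
  it correctly; in an infinite connected one the infimum is over a nonempty family.\<close>

definition anchored_expansion :: "'v set \<Rightarrow> 'v set set \<Rightarrow> 'v \<Rightarrow> ereal" where
  "anchored_expansion V E r =
     lim (\<lambda>n. INF S\<in>anchored_sets V E r n.
                ereal (real (card (edge_boundary V E S)) / real (card S)))"

lemma anchored_expansion_LIMSEQ:
  "(\<lambda>n. INF S\<in>anchored_sets V E r n.
          ereal (real (card (edge_boundary V E S)) / real (card S)))
     \<longlonglongrightarrow> anchored_expansion V E r" (is "?X \<longlonglongrightarrow> _")
proof -
  have "incseq ?X"
    by (intro incseq_SucI INF_superset_mono) (auto simp: anchored_sets_def)
  then have "?X \<longlonglongrightarrow> (SUP n. ?X n)"
    by (rule LIMSEQ_SUP)
  then show ?thesis
    unfolding anchored_expansion_def by (simp add: limI)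
qed

text \<open>A configuration assigns to each edge whether it is open.\<close>

definition bond_percolation :: "'v set set \<Rightarrow> real \<Rightarrow> ('v set \<Rightarrow> bool) measure" where
  "bond_percolation E p = PiM E (\<lambda>_. measure_pmf (bernoulli_pmf p))"

definition open_edges :: "'v set set \<Rightarrow> ('v set \<Rightarrow> bool) \<Rightarrow> 'v set set" where
  "open_edges E \<omega> = {e \<in> E. \<omega> e}"

definition cluster_verts ::
    "'v set \<Rightarrow> 'v set set \<Rightarrow> ('v set \<Rightarrow> bool) \<Rightarrow> 'v \<Rightarrow> 'v set" where
  "cluster_verts V E \<omega> r = {v \<in> V. reachable (open_edges E \<omega>) r v}"

definition cluster_edges ::
    "'v set \<Rightarrow> 'v set set \<Rightarrow> ('v set \<Rightarrow> bool) \<Rightarrow> 'v \<Rightarrow> 'v set set" where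
  "cluster_edges V E \<omega> r = induced_edges (open_edges E \<omega>) (cluster_verts V E \<omega> r)"

end

theory Submission
  imports Defs
begin

text \<open>Let \<open>C\<close> be the family of finite connected vertex sets containing \<open>r\<close>, and write
  \<open>\<partial>S\<close> for the edge boundary of \<open>S\<close>. Positive anchored expansion yields a
  constant \<open>K\<close> with \<open>|S| \<le> K |\<partial>S|\<close> for all \<open>S\<close> in \<open>C\<close>
  (\<open>anchored_expansion_pos_imp_isoperimetric\<close>).

  If \<open>S\<close> lies in the open cluster of \<open>r\<close>, then its boundary in the cluster consists of
  exactly the open edges of \<open>\<partial>S\<close> (\<open>edge_boundary_cluster\<close>). It therefore suffices that
  almost surely only finitely many \<open>S\<close> in \<open>C\<close> are bad, meaning that at most
  \<open>|\<partial>S| / (K + 3)\<close> edges of \<open>\<partial>S\<close> are open: every good \<open>S\<close> in the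
  cluster has a boundary there of size at least \<open>|S| / (K (K + 3))\<close>.

  By the first Borel-Cantelli lemma this follows once the probabilities of being bad have a finite
  sum over \<open>C\<close>. For \<open>p\<close> close to 1 a Chernoff bound makes the probability that \<open>S\<close>
  is bad at most \<open>2^(-(K + 1) |\<partial>S|)\<close>, hence at most \<open>2^(-|S| - |\<partial>S|)\<close>
  (\<open>bond_percolation_few_open_edges\<close>). The sum of these weights over \<open>C\<close> is finite by
  an argument due to Kesten: the weight of \<open>S\<close> is a lower bound for the
  probability that \<open>S\<close> is the cluster of \<open>r\<close> in percolation of density one half, and
  these events are disjoint (\<open>summable_on_anchored_sets\<close>).\<close>

section \<open>Connected sets and their boundaries\<close>

lemma reachable_mono:
  assumes "F \<subseteq> F'" "reachable F u v"
  shows "reachable F' u v"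
  using assms(2) unfolding reachable_def
  by (rule rtranclp_mono[THEN predicate2D, rotated]) (use assms(1) in auto)

lemma reachable_exit_edge:
  assumes "reachable F u v" "u \<in> A" "v \<notin> A"
  obtains x y where "x \<in> A" "y \<notin> A" "{x, y} \<in> F"
proof -
  have "\<exists>x y. x \<in> A \<and> y \<notin> A \<and> {x, y} \<in> F"
    using assms unfolding reachable_def by (induction rule: rtranclp_induct) auto
  then show ?thesis using that by blast
qed

lemma connected_graph_induced_mono:
  assumes "F \<subseteq> E" "connected_graph S (induced_edges F S)"
  shows "connected_graph S (induced_edges E S)"
proof -
  have "induced_edges F S \<subseteq> induced_edges E S"
    using assms(1) by (auto simp: induced_edges_def)
  then show ?thesis
    using assms(2) by (auto simp: connected_graph_def intro: reachable_mono)
qed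

text \<open>The edges of a spanning tree, built by adding one vertex and one edge at a time. That the
  edges form a tree is not needed, only that there are fewer of them than vertices.\<close>

lemma connected_graph_spanning_edges:
  assumes "connected_graph S (induced_edges E S)" "finite S" "r \<in> S"
  obtains T where "T \<subseteq> induced_edges E S" "finite T" "card T < card S"
    "\<And>v. v \<in> S \<Longrightarrow> reachable T r v"
proof -
  have grow: "Suc k \<le> card S \<Longrightarrow> \<exists>A T. A \<subseteq> S \<and> r \<in> A \<and> card A = Suc k \<and> T \<subseteq> induced_edges E S \<and>
      finite T \<and> card T \<le> k \<and> (\<forall>v\<in>A. reachable T r v)" for k
  proof (induction k)
    case 0
    show ?case
      using assms(3) by (intro exI[of _ "{r}"] exI[of _ "{}"]) (auto simp: reachable_def)
  next
    case (Suc k)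
    then obtain A T where A: "A \<subseteq> S" "r \<in> A" "card A = Suc k" "T \<subseteq> induced_edges E S"
      "finite T" "card T \<le> k" "\<And>v. v \<in> A \<Longrightarrow> reachable T r v"
      by auto
    have "A \<noteq> S"
      using A(3) Suc.prems by auto
    then obtain z where z: "z \<in> S" "z \<notin> A"
      using A(1) by blast
    have "reachable (induced_edges E S) r z"
      using assms(1,3) z by (auto simp: connected_graph_def)
    then obtain x y where xy: "x \<in> A" "y \<notin> A" "{x, y} \<in> induced_edges E S"
      using A(2) z(2) by (rule reachable_exit_edge)
    let ?T = "insert {x, y} T"
    have old: "reachable ?T r v" if "v \<in> A" for v
      using A(7)[OF that] by (rule reachable_mono[rotated]) auto
    have "reachable ?T r y"
      using old[OF xy(1)] unfolding reachable_def by (rule rtranclp.rtrancl_into_rtrancl) simp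
    moreover have "y \<in> S"
      using xy(3) by (auto simp: induced_edges_def)
    moreover have "card (insert y A) = Suc (Suc k)"
      using A(1,3) xy(2) assms(2) finite_subset[of A S] by simp
    moreover have "card ?T \<le> Suc k"
      using A(6) card_insert_le_m1[of "Suc k" T "{x, y}"] by simp
    ultimately show ?case
      using A xy old by (intro exI[of _ "insert y A"] exI[of _ ?T]) auto
  qed
  have pos: "card S > 0"
    using assms(2,3) card_gt_0_iff by blast
  then obtain A T where A: "A \<subseteq> S" "card A = card S" "T \<subseteq> induced_edges E S"
      "finite T" "card T \<le> card S - 1" "\<forall>v\<in>A. reachable T r v"
    using grow[of "card S - 1"] by auto
  have "A = S"
    using A(1,2) assms(2) by (simp add: card_subset_eq)
  then show ?thesis
    using that[of T] A pos by auto
qed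

lemma finite_edge_boundary:
  assumes "locally_finite_graph V E" "S \<subseteq> V" "finite S"
  shows "finite (edge_boundary V E S)"
proof (rule finite_subset)
  show "edge_boundary V E S \<subseteq> (\<Union>v\<in>S. {e \<in> E. v \<in> e})"
    by (auto simp: edge_boundary_def)
  show "finite (\<Union>v\<in>S. {e \<in> E. v \<in> e})"
    using assms by (auto simp: locally_finite_graph_def)
qed

lemma edge_boundary_nonempty:
  assumes "simple_graph V E" "connected_graph V E" "S \<subseteq> V" "S \<noteq> {}" "S \<noteq> V"
  shows "edge_boundary V E S \<noteq> {}"
proof -
  obtain u v where uv: "u \<in> S" "v \<in> V" "v \<notin> S"
    using assms(3-5) by blast
  have "reachable E u v"
    using assms(2,3) uv by (auto simp: connected_graph_def)
  then obtain x y where xy: "x \<in> S" "y \<notin> S" "{x, y} \<in> E"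
    using uv(1,3) by (rule reachable_exit_edge)
  have "y \<in> V"
    using assms(1) xy(3) by (auto simp: simple_graph_def)
  then show ?thesis
    using xy by (auto simp: edge_boundary_def)
qed

text \<open>The definition of the anchored expansion only constrains large sets. In an infinite connected
  graph the small ones satisfy a linear isoperimetric inequality as well, since their boundaries are
  nonempty.\<close>

lemma anchored_expansion_pos_imp_isoperimetric:
  assumes "simple_graph V E" "infinite V" "connected_graph V E" "locally_finite_graph V E"
    and "anchored_expansion V E r > 0"
  obtains K :: nat where "K > 0"
    "\<And>S. S \<in> anchored_sets V E r 0 \<Longrightarrow> card S \<le> K * card (edge_boundary V E S)"
proof -
  let ?q = "\<lambda>S. real (card (edge_boundary V E S)) / real (card S)"
  let ?X = "\<lambda>n. INF S\<in>anchored_sets V E r n. ereal (?q S)"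
  have "eventually (\<lambda>n. ?X n > 0) sequentially"
    using anchored_expansion_LIMSEQ assms(5) by (rule order_tendstoD(1))
  then obtain n where n: "?X n > 0"
    by (auto simp: eventually_sequentially)
  then obtain d :: real where d: "ereal d < ?X n" "d > 0"
    using ereal_dense3[of 0 "?X n"] ereal_dense2[of 0 "?X n"] by auto
  define m :: nat where "m = nat \<lceil>1 / d\<rceil>"
  show ?thesis
  proof (rule that[of "m + n + 1"])
    fix S assume S: "S \<in> anchored_sets V E r 0"
    then have fin: "finite S" "S \<subseteq> V" "r \<in> S"
      by (auto simp: anchored_sets_def)
    let ?b = "card (edge_boundary V E S)"
    have "edge_boundary V E S \<noteq> {}"
      using fin assms(1,2,3) by (intro edge_boundary_nonempty) auto
    then have b: "?b \<ge> 1"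
      using finite_edge_boundary[OF assms(4) fin(2,1)] by (simp add: Suc_le_eq card_gt_0_iff)
    show "card S \<le> (m + n + 1) * ?b"
    proof (cases "n \<le> card S")
      case True
      then have "S \<in> anchored_sets V E r n"
        using S by (auto simp: anchored_sets_def)
      then have "ereal d < ereal (?q S)"
        using d(1) by (meson INF_lower less_le_trans)
      moreover have "card S > 0"
        using fin card_gt_0_iff by blast
      ultimately have "real (card S) * d \<le> real ?b"
        by (simp add: field_simps)
      then have "real (card S) \<le> (1 / d) * real ?b"
        using d(2) by (simp add: field_simps)
      also have "\<dots> \<le> real m * real ?b"
        unfolding m_def by (intro mult_right_mono) linarith+
      finally have "card S \<le> m * ?b"
        by (metis of_nat_le_iff of_nat_mult)
      then show ?thesis
        by (simp add: algebra_simps)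
    next
      case False
      then show ?thesis
        using mult_le_mono2[OF b, of "m + n + 1"] by simp
    qed
  qed simp
qed

section \<open>Bernoulli percolation\<close>

lemma prob_space_bond_percolation: "prob_space (bond_percolation E p)"
  unfolding bond_percolation_def by (intro prob_space_PiM measure_pmf.prob_space_axioms)

lemma measurable_bond_percolation_component:
  "e \<in> E \<Longrightarrow> (\<lambda>\<omega>. \<omega> e) \<in> bond_percolation E p \<rightarrow>\<^sub>M count_space UNIV"
  unfolding bond_percolation_def
  by (rule measurable_compose[OF measurable_component_singleton]) auto

lemma nn_integral_bond_percolation_prod:
  fixes g :: "'v set \<Rightarrow> bool \<Rightarrow> ennreal"
  assumes "J \<subseteq> E" "finite J" "0 \<le> p" "p \<le> 1"
  shows "(\<integral>\<^sup>+\<omega>. (\<Prod>e\<in>J. g e (\<omega> e)) \<partial>bond_percolation E p) =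
    (\<Prod>e\<in>J. g e True * ennreal p + g e False * ennreal (1 - p))"
proof (cases "E = {}")
  case True
  then show ?thesis
    using assms(1) prob_space.emeasure_space_1[OF prob_space_bond_percolation] by simp
next
  case False
  let ?B = "measure_pmf (bernoulli_pmf p)"
  let ?M = "bond_percolation E p"
  interpret prob_space ?M
    by (rule prob_space_bond_percolation)
  have marginal: "distr ?M ?B (\<lambda>\<omega>. \<omega> e) = ?B" if "e \<in> E" for e
    unfolding bond_percolation_def
    using that by (intro distr_PiM_component measure_pmf.prob_space_axioms)
  have rv: "random_variable ?B (\<lambda>\<omega>. \<omega> e)" if "e \<in> E" for e
    using measurable_bond_percolation_component[OF that] by simp
  \<comment> \<open>The coordinates are independent, since their joint law is the product of their laws.\<close>
  have "indep_vars (\<lambda>_. ?B) (\<lambda>e \<omega>. \<omega> e) E"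
  proof (subst indep_vars_iff_distr_eq_PiM'[OF False rv])
    have "distr ?M (Pi\<^sub>M E (\<lambda>_. ?B)) (\<lambda>\<omega>. restrict \<omega> E) = distr ?M ?M (\<lambda>\<omega>. \<omega>)"
      by (intro distr_cong) (auto simp: bond_percolation_def space_PiM PiE_restrict)
    also have "\<dots> = (\<Pi>\<^sub>M e\<in>E. distr ?M ?B (\<lambda>\<omega>. \<omega> e))"
      unfolding distr_id by (subst bond_percolation_def, intro PiM_cong) (simp_all add: marginal)
    finally show "distr ?M (Pi\<^sub>M E (\<lambda>_. ?B)) (\<lambda>\<omega>. \<lambda>e\<in>E. \<omega> e) = (\<Pi>\<^sub>M e\<in>E. distr ?M ?B (\<lambda>\<omega>. \<omega> e))" .
  qed simp
  then have "indep_vars (\<lambda>_. ?B) (\<lambda>e \<omega>. \<omega> e) J"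
    using assms(1) by (rule indep_vars_subset)
  then have "indep_vars (\<lambda>_. borel) (\<lambda>e \<omega>. g e (\<omega> e)) J"
    by (rule indep_vars_compose2) auto
  then have "(\<integral>\<^sup>+\<omega>. (\<Prod>e\<in>J. g e (\<omega> e)) \<partial>?M) = (\<Prod>e\<in>J. \<integral>\<^sup>+\<omega>. g e (\<omega> e) \<partial>?M)"
    using assms(2) by (intro indep_vars_nn_integral) auto
  also have "\<dots> = (\<Prod>e\<in>J. g e True * ennreal p + g e False * ennreal (1 - p))"
  proof (rule prod.cong[OF refl])
    fix e assume "e \<in> J"
    then have e: "e \<in> E"
      using assms(1) by auto
    have "(\<integral>\<^sup>+\<omega>. g e (\<omega> e) \<partial>?M) = (\<integral>\<^sup>+b. g e b \<partial>distr ?M ?B (\<lambda>\<omega>. \<omega> e))"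
      by (subst nn_integral_distr[OF rv[OF e]]) auto
    then show "(\<integral>\<^sup>+\<omega>. g e (\<omega> e) \<partial>?M) = g e True * ennreal p + g e False * ennreal (1 - p)"
      using assms(3,4) by (simp add: marginal[OF e])
  qed
  finally show ?thesis .
qed

lemma emeasure_bond_percolation_half_cylinder:
  assumes "J \<subseteq> E" "finite J"
  shows "emeasure (bond_percolation E (1/2)) {\<omega> \<in> space (bond_percolation E (1/2)). \<forall>e\<in>J. \<omega> e = c e}
    = ennreal ((1/2) ^ card J)" (is "emeasure ?M ?A = _")
proof -
  have "?A \<in> sets ?M"
  proof (rule sets.sets_Collect_finite_All[OF _ assms(2)])
    fix e assume "e \<in> J"
    then have "(\<lambda>\<omega>. \<omega> e) \<in> ?M \<rightarrow>\<^sub>M count_space UNIV"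
      using assms(1) by (intro measurable_bond_percolation_component) auto
    from measurable_sets[OF this, of "{c e}"]
    show "{\<omega> \<in> space ?M. \<omega> e = c e} \<in> sets ?M"
      by (simp add: vimage_def Int_def conj_commute)
  qed
  then have "emeasure ?M ?A = (\<integral>\<^sup>+\<omega>. indicator ?A \<omega> \<partial>?M)"
    by simp
  also have "\<dots> = (\<integral>\<^sup>+\<omega>. (\<Prod>e\<in>J. indicator {c e} (\<omega> e)) \<partial>?M)"
    using assms(2)
    by (intro nn_integral_cong) (auto simp: indicator_def prod_zero_iff intro!: prod.neutral[symmetric])
  also have "\<dots> = (\<Prod>e\<in>J. indicator {c e} True * ennreal (1/2) + indicator {c e} False * ennreal (1 - 1/2))"
    using assms by (intro nn_integral_bond_percolation_prod) auto
  also have "\<dots> = (\<Prod>e\<in>J. ennreal (1/2))"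
    by (intro prod.cong) (auto simp: indicator_def)
  also have "\<dots> = ennreal ((1/2) ^ card J)"
    by (simp only: prod_constant ennreal_power[symmetric])
  finally show ?thesis .
qed


section \<open>Counting connected sets\<close>

lemma cluster_verts_eqI:
  assumes "simple_graph V E" "S \<subseteq> V" "r \<in> S" "T \<subseteq> E"
    and "\<And>v. v \<in> S \<Longrightarrow> reachable T r v"
    and "\<And>e. e \<in> T \<Longrightarrow> \<omega> e" "\<And>e. e \<in> edge_boundary V E S \<Longrightarrow> \<not> \<omega> e"
  shows "cluster_verts V E \<omega> r = S"
proof
  have "T \<subseteq> open_edges E \<omega>"
    using assms(4,6) by (auto simp: open_edges_def)
  then show "S \<subseteq> cluster_verts V E \<omega> r"
    using assms(2,5) by (auto simp: cluster_verts_def intro: reachable_mono)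
  show "cluster_verts V E \<omega> r \<subseteq> S"
  proof (rule subsetI, rule ccontr)
    fix v assume v: "v \<in> cluster_verts V E \<omega> r" "v \<notin> S"
    then have "reachable (open_edges E \<omega>) r v"
      by (simp add: cluster_verts_def)
    then obtain x y where xy: "x \<in> S" "y \<notin> S" "{x, y} \<in> open_edges E \<omega>"
      using assms(3) v(2) by (rule reachable_exit_edge)
    have e: "{x, y} \<in> E" "\<omega> {x, y}"
      using xy(3) by (auto simp: open_edges_def)
    then have "y \<in> V"
      using assms(1) by (auto simp: simple_graph_def)
    then have "{x, y} \<in> edge_boundary V E S"
      using xy e by (auto simp: edge_boundary_def)
    then show False
      using assms(7) e(2) by blast
  qed
qed

text \<open>A bound on the number of connected sets, in the weighted form that a union bound uses.
  In percolation of density one half the events that the cluster of \<open>r\<close> is \<open>S\<close>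
  are disjoint for different \<open>S\<close>, and such an event has probability at least
  \<open>(1/2) ^ (card S + card (edge_boundary V E S))\<close>: it suffices that fewer than \<open>card S\<close>
  spanning edges are open and the boundary is closed.\<close>

lemma summable_on_anchored_sets:
  assumes "simple_graph V E" "locally_finite_graph V E"
  shows "(\<lambda>S. (1/2::real) ^ (card S + card (edge_boundary V E S))) summable_on anchored_sets V E r 0"
proof -
  let ?M = "bond_percolation E (1/2)"
  let ?C = "anchored_sets V E r 0"
  let ?w = "\<lambda>S. (1/2::real) ^ (card S + card (edge_boundary V E S))"
  interpret prob_space ?M
    by (rule prob_space_bond_percolation)
  have ex: "\<forall>S\<in>?C. \<exists>T. T \<subseteq> induced_edges E S \<and> finite T \<and> card T < card S \<and> (\<forall>v\<in>S. reachable T r v)"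
  proof
    fix S assume "S \<in> ?C"
    then have "connected_graph S (induced_edges E S)" "finite S" "r \<in> S"
      by (auto simp: anchored_sets_def)
    then obtain T where "T \<subseteq> induced_edges E S" "finite T" "card T < card S"
        "\<And>v. v \<in> S \<Longrightarrow> reachable T r v"
      by (rule connected_graph_spanning_edges) blast
    then show "\<exists>T. T \<subseteq> induced_edges E S \<and> finite T \<and> card T < card S \<and> (\<forall>v\<in>S. reachable T r v)"
      by blast
  qed
  obtain T where T: "\<And>S. S \<in> ?C \<Longrightarrow> T S \<subseteq> induced_edges E S" "\<And>S. S \<in> ?C \<Longrightarrow> finite (T S)"
      "\<And>S. S \<in> ?C \<Longrightarrow> card (T S) < card S" "\<And>S v. S \<in> ?C \<Longrightarrow> v \<in> S \<Longrightarrow> reachable (T S) r v"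
    using bchoice[OF ex] by blast
  define J where "J S = T S \<union> edge_boundary V E S" for S
  define A where "A S = {\<omega> \<in> space ?M. \<forall>e\<in>J S. \<omega> e = (e \<in> T S)}" for S
  have J: "J S \<subseteq> E" "finite (J S)" "card (J S) \<le> card S + card (edge_boundary V E S)"
    if S: "S \<in> ?C" for S
  proof -
    have S': "S \<subseteq> V" "finite S"
      using S by (auto simp: anchored_sets_def)
    show "J S \<subseteq> E"
      using T(1)[OF S] by (auto simp: J_def induced_edges_def edge_boundary_def)
    show "finite (J S)"
      using T(2)[OF S] finite_edge_boundary[OF assms(2) S'] by (simp add: J_def)
    show "card (J S) \<le> card S + card (edge_boundary V E S)"
      using T(3)[OF S] card_Un_le[of "T S" "edge_boundary V E S"] by (simp add: J_def)
  qed
  have w: "?w S \<le> prob (A S)" "A S \<in> events" if S: "S \<in> ?C" for S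
  proof -
    have "emeasure ?M (A S) = ennreal ((1/2) ^ card (J S))"
      unfolding A_def using J(1,2)[OF S] by (rule emeasure_bond_percolation_half_cylinder)
    then have m: "prob (A S) = (1/2) ^ card (J S)"
      by (simp add: measure_def)
    show "?w S \<le> prob (A S)"
      unfolding m using J(3)[OF S] by (intro power_decreasing) auto
    \<comment> \<open>A set outside the sigma algebra would have measure 0 by convention.\<close>
    show "A S \<in> events"
      using m measure_notin_sets[of "A S" ?M] by fastforce
  qed
  have cluster: "cluster_verts V E \<omega> r = S" if S: "S \<in> ?C" and \<omega>: "\<omega> \<in> A S" for S \<omega>
  proof (rule cluster_verts_eqI[OF assms(1)])
    have sub: "e \<subseteq> S" if "e \<in> T S" for e
      using T(1)[OF S] that by (auto simp: induced_edges_def)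
    show "\<not> \<omega> e" if "e \<in> edge_boundary V E S" for e
    proof -
      have "\<not> e \<subseteq> S"
        using that by (auto simp: edge_boundary_def)
      then show ?thesis
        using sub \<omega> that by (auto simp: A_def J_def)
    qed
    show "\<omega> e" if "e \<in> T S" for e
      using \<omega> that by (auto simp: A_def J_def)
    show "T S \<subseteq> E"
      using T(1)[OF S] by (auto simp: induced_edges_def)
  qed (use S T(4) in \<open>auto simp: anchored_sets_def\<close>)
  have "sum ?w F \<le> 1" if F: "F \<subseteq> ?C" "finite F" for F
  proof -
    have "sum ?w F \<le> (\<Sum>S\<in>F. prob (A S))"
      using F(1) w(1) by (intro sum_mono) auto
    also have "\<dots> = prob (\<Union>S\<in>F. A S)"
    proof (rule finite_measure_finite_Union[symmetric])
      show "disjoint_family_on A F"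
        unfolding disjoint_family_on_def using cluster F(1) by blast
    qed (use F w(2) in auto)
    also have "\<dots> \<le> 1"
      by (rule prob_le_1)
    finally show ?thesis .
  qed
  then show ?thesis
    by (intro nonneg_bdd_above_summable_on) (auto simp: bdd_above_def)
qed

section \<open>Few open boundary edges\<close>

text \<open>A Chernoff bound: Markov's inequality for \<open>t ^ N\<close>, where \<open>N\<close> is the number of open
  edges in \<open>B\<close> and \<open>t = (1/2) ^ (K + 3)\<close>. On the event \<open>(K + 3) * N \<le> card B\<close>
  this variable is at least \<open>(1/2) ^ card B\<close>.\<close>

lemma bond_percolation_few_open_edges:
  fixes K :: nat
  assumes B: "B \<subseteq> E" "finite B" and p: "1 - (1/2) ^ (K + 3) \<le> p" "p \<le> 1"
  defines "A \<equiv> {\<omega> \<in> space (bond_percolation E p). (K + 3) * card {e \<in> B. \<omega> e} \<le> card B}"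
  shows "A \<in> sets (bond_percolation E p)"
    and "measure (bond_percolation E p) A \<le> (1/2) ^ ((K + 1) * card B)"
proof -
  let ?M = "bond_percolation E p"
  interpret prob_space ?M
    by (rule prob_space_bond_percolation)
  define t :: real where "t = (1/2) ^ (K + 3)"
  have t: "0 < t" "t \<le> 1" "4 * t = (1/2) ^ (K + 1)"
    unfolding t_def by (rule zero_less_power, simp) (rule power_le_one, simp_all add: power_add eval_nat_numeral)
  have p0: "0 \<le> p"
    using p(1) t(2) by (simp add: t_def)
  define f where "f \<omega> = (\<Prod>e\<in>B. if \<omega> e then ennreal t else 1)" for \<omega> :: "'a set \<Rightarrow> bool"
  have f: "f \<omega> = ennreal (t ^ card {e \<in> B. \<omega> e})" for \<omega>
  proof -
    have "f \<omega> = (\<Prod>e\<in>{e \<in> B. \<omega> e}. ennreal t)"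
      unfolding f_def using B(2) by (rule prod.inter_filter[symmetric])
    then show ?thesis
      using t(1) by (simp add: ennreal_power)
  qed
  have comp: "(\<lambda>\<omega>. \<omega> e) \<in> ?M \<rightarrow>\<^sub>M count_space UNIV" if "e \<in> B" for e
    using B(1) that by (intro measurable_bond_percolation_component) auto
  have f_meas: "f \<in> borel_measurable ?M"
    unfolding f_def
    by (intro borel_measurable_prod_ennreal measurable_compose[OF comp]) auto
  have iff: "(K + 3) * k \<le> n \<longleftrightarrow> 1 \<le> ennreal (2 ^ n) * ennreal (t ^ k)" for k n
  proof -
    have "1 \<le> ennreal (2 ^ n) * ennreal (t ^ k) \<longleftrightarrow> 1 \<le> 2 ^ n * t ^ k"
      using t(1) by (simp flip: ennreal_mult)
    also have "2 ^ n * t ^ k = 2 ^ n / 2 ^ ((K + 3) * k)"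
      by (simp add: t_def power_mult power_one_over power_divide)
    also have "1 \<le> (2 ^ n / 2 ^ ((K + 3) * k) :: real) \<longleftrightarrow> (2::real) ^ ((K + 3) * k) \<le> 2 ^ n"
      by (simp add: field_simps)
    also have "\<dots> \<longleftrightarrow> (K + 3) * k \<le> n"
      by (rule power_increasing_iff) simp
    finally show ?thesis by simp
  qed
  have A_eq: "A = {\<omega> \<in> space ?M. 1 \<le> ennreal (2 ^ card B) * f \<omega>}"
    unfolding A_def f iff ..
  show A_sets: "A \<in> sets ?M"
    unfolding A_eq using f_meas by measurable
  have "emeasure ?M A \<le> ennreal (2 ^ card B) * (\<integral>\<^sup>+\<omega>. f \<omega> * indicator (space ?M) \<omega> \<partial>?M)"
    unfolding A_eq using f_meas by (intro nn_integral_Markov_inequality) auto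
  also have "(\<integral>\<^sup>+\<omega>. f \<omega> * indicator (space ?M) \<omega> \<partial>?M) = (\<integral>\<^sup>+\<omega>. f \<omega> \<partial>?M)"
    by (intro nn_integral_cong) auto
  also have "\<dots> = (\<Prod>e\<in>B. ennreal t * ennreal p + 1 * ennreal (1 - p))"
    unfolding f_def
    by (subst nn_integral_bond_percolation_prod[where g = "\<lambda>e b. if b then ennreal t else 1"])
       (use B p0 p(2) in auto)
  also have "\<dots> = ennreal ((t * p + (1 - p)) ^ card B)"
    using t(1) p0 p(2) by (simp add: ennreal_power flip: ennreal_mult ennreal_plus)
  also have "ennreal (2 ^ card B) * \<dots> = ennreal ((2 * (t * p + (1 - p))) ^ card B)"
    unfolding power_mult_distrib using t(1) p0 p(2) by (intro ennreal_mult[symmetric]) auto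
  also have "\<dots> \<le> ennreal (((1/2) ^ (K + 1)) ^ card B)"
  proof (intro ennreal_leI power_mono)
    have "t * p \<le> t"
      using t(1) p(2) by (simp add: mult_left_le)
    moreover have "1 - p \<le> t"
      using p(1) by (simp add: t_def)
    ultimately have "t * p + (1 - p) \<le> t + t"
      by (rule add_mono)
    then have "2 * (t * p + (1 - p)) \<le> 4 * t"
      by simp
    then show "2 * (t * p + (1 - p)) \<le> (1/2) ^ (K + 1)"
      unfolding t(3) .
    show "0 \<le> 2 * (t * p + (1 - p))"
      using t(1) p0 p(2) by simp
  qed
  finally show "prob A \<le> (1/2) ^ ((K + 1) * card B)"
    unfolding emeasure_eq_measure power_mult by (simp add: ennreal_le_iff)
qed

text \<open>The first Borel-Cantelli lemma for events indexed by a countable set.\<close>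

lemma (in prob_space) borel_cantelli_countable:
  fixes A :: "'i \<Rightarrow> 'a set"
  assumes "countable I" "\<And>i. i \<in> I \<Longrightarrow> A i \<in> events" "(\<lambda>i. prob (A i)) summable_on I"
  shows "AE \<omega> in M. finite {i \<in> I. \<omega> \<in> A i}"
proof (cases "finite I")
  case False
  let ?g = "from_nat_into I"
  have g: "bij_betw ?g UNIV I"
    using assms(1) False by (rule bij_betw_from_nat_into)
  have "(\<lambda>n. prob (A (?g n))) summable_on UNIV"
    using assms(3) summable_on_reindex_bij_betw[OF g, of "\<lambda>i. prob (A i)"] by simp
  then have "summable (\<lambda>n. prob (A (?g n)))"
    by (rule summable_on_imp_summable)
  then have "AE \<omega> in M. eventually (\<lambda>n. \<omega> \<in> space M - A (?g n)) sequentially"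
    using g assms(2) by (intro borel_cantelli_AE1) (auto simp: bij_betw_def less_top[symmetric])
  then show ?thesis
  proof eventually_elim
    case (elim \<omega>)
    then obtain N where N: "\<And>n. n \<ge> N \<Longrightarrow> \<omega> \<notin> A (?g n)"
      by (auto simp: eventually_sequentially)
    have "{i \<in> I. \<omega> \<in> A i} \<subseteq> ?g ` {..<N}"
    proof
      fix i assume i: "i \<in> {i \<in> I. \<omega> \<in> A i}"
      then obtain n where n: "i = ?g n"
        using g by (auto simp: bij_betw_def)
      then have "n < N"
        using N[of n] i by (cases "n < N") auto
      then show "i \<in> ?g ` {..<N}"
        using n by blast
    qed
    then show ?case
      by (rule finite_subset) simp
  qed
qed simp

section \<open>Anchored expansion of the cluster\<close>

lemma edge_boundary_cluster:
  assumes "simple_graph V E" "S \<subseteq> cluster_verts V E \<omega> r"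
  shows "edge_boundary (cluster_verts V E \<omega> r) (cluster_edges V E \<omega> r) S
    = {e \<in> edge_boundary V E S. \<omega> e}"
proof
  let ?C = "cluster_verts V E \<omega> r"
  show "edge_boundary ?C (cluster_edges V E \<omega> r) S \<subseteq> {e \<in> edge_boundary V E S. \<omega> e}"
    by (auto simp: edge_boundary_def cluster_edges_def induced_edges_def open_edges_def cluster_verts_def)
  show "{e \<in> edge_boundary V E S. \<omega> e} \<subseteq> edge_boundary ?C (cluster_edges V E \<omega> r) S"
  proof
    fix e assume "e \<in> {e \<in> edge_boundary V E S. \<omega> e}"
    then obtain u v where e: "e = {u, v}" "u \<in> S" "v \<in> V" "v \<notin> S" "e \<in> open_edges E \<omega>"
      by (auto simp: edge_boundary_def open_edges_def)
    have u: "u \<in> ?C"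
      using assms(2) e(2) by blast
    then have "reachable (open_edges E \<omega>) r v"
      using e(1,5) unfolding cluster_verts_def reachable_def
      by (auto intro: rtranclp.rtrancl_into_rtrancl)
    then have "v \<in> ?C"
      using e(3) by (simp add: cluster_verts_def)
    then show "e \<in> edge_boundary ?C (cluster_edges V E \<omega> r) S"
      using u e by (auto simp: edge_boundary_def cluster_edges_def induced_edges_def)
  qed
qed

lemma anchored_sets_cluster_subset:
  "anchored_sets (cluster_verts V E \<omega> r) (cluster_edges V E \<omega> r) r n \<subseteq> anchored_sets V E r n"
proof -
  have "cluster_edges V E \<omega> r \<subseteq> E"
    by (auto simp: cluster_edges_def induced_edges_def open_edges_def)
  then show ?thesis
    by (auto simp: anchored_sets_def cluster_verts_def intro: connected_graph_induced_mono)
qed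

lemma anchored_expansion_ge:
  assumes "\<And>S. S \<in> anchored_sets V E r n \<Longrightarrow> c * real (card S) \<le> real (card (edge_boundary V E S))"
  shows "ereal c \<le> anchored_expansion V E r"
proof (rule LIMSEQ_le_const[OF anchored_expansion_LIMSEQ], intro exI allI impI INF_greatest)
  fix m S assume m: "n \<le> m" and S: "S \<in> anchored_sets V E r m"
  have "S \<in> anchored_sets V E r n"
    using m S by (auto simp: anchored_sets_def)
  then have "c * real (card S) \<le> real (card (edge_boundary V E S))"
    by (rule assms)
  moreover have "card S > 0"
    using S by (auto simp: anchored_sets_def card_gt_0_iff)
  ultimately show "ereal c \<le> ereal (real (card (edge_boundary V E S)) / real (card S))"
    by (simp add: field_simps)
qed

text \<open>The conclusion holds for finite clusters too: for \<open>n\<close> beyond the size of the cluster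
  the infimum is over the empty family, so the anchored expansion is \<open>\<infinity>\<close>.\<close>

lemma AE_cluster_anchored_expansion_pos:
  fixes V :: "'v set" and K :: nat
  assumes G: "simple_graph V E" "locally_finite_graph V E"
    and K: "K > 0" "\<And>S. S \<in> anchored_sets V E r 0 \<Longrightarrow> card S \<le> K * card (edge_boundary V E S)"
    and p: "1 - (1/2) ^ (K + 3) \<le> p" "p \<le> 1"
  shows "AE \<omega> in bond_percolation E p.
    anchored_expansion (cluster_verts V E \<omega> r) (cluster_edges V E \<omega> r) r > 0"
proof -
  let ?M = "bond_percolation E p"
  let ?C = "anchored_sets V E r 0"
  let ?b = "\<lambda>S. edge_boundary V E S"
  let ?w = "\<lambda>S. (1/2::real) ^ (card S + card (?b S))"
  interpret prob_space ?M
    by (rule prob_space_bond_percolation)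
  define A where "A S = {\<omega> \<in> space ?M. (K + 3) * card {e \<in> ?b S. \<omega> e} \<le> card (?b S)}" for S
  have fin: "?b S \<subseteq> E" "finite (?b S)" if "S \<in> ?C" for S
    using that finite_edge_boundary[OF G(2)] by (auto simp: anchored_sets_def edge_boundary_def)
  have A: "A S \<in> events" "prob (A S) \<le> ?w S" if S: "S \<in> ?C" for S
  proof -
    show "A S \<in> events"
      unfolding A_def using fin[OF S] p by (rule bond_percolation_few_open_edges)
    have "prob (A S) \<le> (1/2) ^ ((K + 1) * card (?b S))"
      unfolding A_def using fin[OF S] p by (rule bond_percolation_few_open_edges)
    also have "\<dots> \<le> ?w S"
      using K(2)[OF S] by (intro power_decreasing) auto
    finally show "prob (A S) \<le> ?w S" .
  qed
  have w: "?w summable_on ?C"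
    using G by (rule summable_on_anchored_sets)
  have "countable {S \<in> ?C. ?w S \<noteq> 0}"
    using w by (rule summable_countable_real)
  \<comment> \<open>All weights are positive, so summability forces the family itself to be countable.\<close>
  then have "countable ?C"
    by simp
  moreover have "(\<lambda>S. prob (A S)) summable_on ?C"
    using w by (rule summable_on_comparison_test) (use A(2) in auto)
  ultimately have "AE \<omega> in ?M. finite {S \<in> ?C. \<omega> \<in> A S}"
    using A(1) by (intro borel_cantelli_countable)
  moreover have "AE \<omega> in ?M. \<omega> \<in> space ?M"
    by (rule AE_space)
  ultimately show ?thesis
  proof eventually_elim
    case (elim \<omega>)
    let ?V = "cluster_verts V E \<omega> r" and ?E = "cluster_edges V E \<omega> r"
    obtain n where n: "\<And>S. S \<in> ?C \<Longrightarrow> \<omega> \<in> A S \<Longrightarrow> card S < n"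
      using finite_imageI[OF elim(1), of card] by (auto simp: finite_nat_set_iff_bounded)
    have bound: "ereal (1 / (K * (K + 3))) \<le> anchored_expansion ?V ?E r"
    proof (rule anchored_expansion_ge[where n = n])
      fix S assume S: "S \<in> anchored_sets ?V ?E r n"
      then have "S \<in> anchored_sets V E r n" and sub: "S \<subseteq> ?V"
        using anchored_sets_cluster_subset[of V E \<omega> r n] by (auto simp: anchored_sets_def)
      then have C: "S \<in> ?C" and "n \<le> card S"
        by (auto simp: anchored_sets_def)
      then have "\<omega> \<notin> A S"
        using n by force
      then have "card (?b S) \<le> (K + 3) * card {e \<in> ?b S. \<omega> e}"
        using elim(2) by (simp add: A_def)
      then have "K * card (?b S) \<le> K * ((K + 3) * card {e \<in> ?b S. \<omega> e})"
        by (rule mult_le_mono2)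
      then have "card S \<le> (K * (K + 3)) * card {e \<in> ?b S. \<omega> e}"
        using K(2)[OF C] by (simp only: mult.assoc)
      then have "real (card S) \<le> real (K * (K + 3)) * real (card (edge_boundary ?V ?E S))"
        unfolding edge_boundary_cluster[OF G(1) sub] by (simp only: of_nat_mult[symmetric] of_nat_le_iff)
      moreover have "real (K * (K + 3)) > 0"
        using K(1) by simp
      ultimately show "1 / real (K * (K + 3)) * real (card S) \<le> real (card (edge_boundary ?V ?E S))"
        by (simp only: times_divide_eq_left mult_1_left pos_divide_le_eq mult.commute[of "real (K * (K + 3))"])
    qed
    have "ereal 0 < ereal (1 / (K * (K + 3)))"
      using K(1) by simp
    from less_le_trans[OF this bound] show ?case
      by (simp only: zero_ereal_def)
  qed
qed

theorem theorem1p1: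
  fixes V :: "'v set" and E :: "'v set set" and r :: 'v
  assumes "simple_graph V E"
    and "infinite V"
    and "connected_graph V E"
    and "locally_finite_graph V E"
    and "r \<in> V"
    and "anchored_expansion V E r > 0"
  shows "\<exists>p0::real. 0 \<le> p0 \<and> p0 < 1 \<and>
    (\<forall>p\<in>{p0<..<1}.
      AE \<omega> in bond_percolation E p.
        infinite (cluster_verts V E \<omega> r) \<longrightarrow>
          anchored_expansion (cluster_verts V E \<omega> r) (cluster_edges V E \<omega> r) r > 0)"
proof -
  obtain K :: nat where K: "K > 0"
      "\<And>S. S \<in> anchored_sets V E r 0 \<Longrightarrow> card S \<le> K * card (edge_boundary V E S)"
    using assms(1-4,6) by (rule anchored_expansion_pos_imp_isoperimetric) blast
  show ?thesis
  proof (intro exI[of _ "1 - (1/2) ^ (K + 3)"] conjI ballI)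
    fix p :: real assume p: "p \<in> {1 - (1/2) ^ (K + 3)<..<1}"
    have "AE \<omega> in bond_percolation E p.
        anchored_expansion (cluster_verts V E \<omega> r) (cluster_edges V E \<omega> r) r > 0"
      using p by (intro AE_cluster_anchored_expansion_pos[OF assms(1,4) K]) auto
    then show "AE \<omega> in bond_percolation E p. infinite (cluster_verts V E \<omega> r) \<longrightarrow>
        anchored_expansion (cluster_verts V E \<omega> r) (cluster_edges V E \<omega> r) r > 0"
      by eventually_elim simp
  qed (auto simp: power_le_one)
qed

end
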